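(* Let $G=(V,\mathcal D,\ell_v)$ and $G'=(V',\mathcal D',\ell'_v)$ be finite node-labeled digraphs, each of which is weakly connected, simple and oriented. Then the extended line digraphs satisfy $\mathcal L(G)\cong\mathcal L(G')$ (as labeled digraphs) if and only if $G\cong G'$ (as node-labeled digraphs).
   Context: A node-labeled digraph $G=(V,\mathcal D,\ell_v)$ consists of a finite node set $V$, a set of directed edges $\mathcal D\subseteq V\times V$ (edge $(u,v)$ goes from tail $u$ to head $v$), and a node-labeling function $\ell_v$ from $V$ to a label set. A labeled digraph additionally carries an edge-labeling function $\ell_e$ on its edges. Assumptions: weakly connected means the underlying undirected graph is connected; simple means no self-loops $(v,v)$ and no parallel edges with the same source and target; oriented means there are no two nodes $u,v$ with both $(u,v)\in\mathcal D$ and $(v,u)\in\mathcal D$. An isomorphism of labeled digraphs $(V,\mathcal D,\ell_v,\ell_e)\to(V',\mathcal D',\ell'_v,\ell'_e)$ is a bijection $\gamma:V\to V'$ with $\ell'_v(\gamma(v))=\ell_v(v)$ for all $v$, with $(u,v)\in\mathcal D$ iff $(\gamma(u),\gamma(v))\in\mathcal D'$, and with $\ell'_e((\gamma(u),\gamma(v)))=\ell_e((u,v))$ for all $(u,v)\in\mathcal D$; for node-labeled digraphs the edge-label condition is omitted. The extended line digraph of a simple node-labeled digraph $G=(V,\mathcal D,\ell_v)$ is the labeled digraph $\mathcal L(G)=(\mathcal D,\mathcal D_L,\bar\ell_v,\bar\ell_e)$ whose nodes are the edges of $G$, with node labels $\bar\ell_v((u,v))=(\ell_v(u),\ell_v(v))$,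 and whose edges are defined as follows for distinct $e=(u,v),\hat e=(\hat u,\hat v)\in\mathcal D$: $(e,\hat e)\in\mathcal D_L$ with label $ht$ iff $v=\hat u$ (head meets tail); $(e,\hat e),(\hat e,e)\in\mathcal D_L$ with label $tt$ iff $u=\hat u$ (tail meets tail); $(e,\hat e),(\hat e,e)\in\mathcal D_L$ with label $hh$ iff $v=\hat v$ (head meets head).
   Formalization: The formal theorem assumes the two digraphs are nonempty and not both edgeless: two one-node digraphs without edges but with different node labels have isomorphic (empty) extended line digraphs and are not isomorphic. *)

theory Defs
  imports "Graph_Theory.Digraph_Component"
begin

record ('a, 'l) node_labeled_digraph =
  digraph_of :: "'a pair_pre_digraph"
  nlabel :: "'a \<Rightarrow> 'l"

record ('a, 'l, 'm) labeled_digraph = "('a, 'l) node_labeled_digraph" +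
  elabel :: "'a \<times> 'a \<Rightarrow> 'm"

definition oriented :: "'a pair_pre_digraph \<Rightarrow> bool" where
  "oriented G \<longleftrightarrow> \<not> (\<exists>u v. (u, v) \<in> parcs G \<and> (v, u) \<in> parcs G)"

definition is_node_labeled_iso ::
  "('a, 'l, 'x) node_labeled_digraph_scheme \<Rightarrow> ('b, 'l, 'y) node_labeled_digraph_scheme
    \<Rightarrow> ('a \<Rightarrow> 'b) \<Rightarrow> bool" where
  "is_node_labeled_iso G H \<gamma> \<longleftrightarrow>
     bij_betw \<gamma> (pverts (digraph_of G)) (pverts (digraph_of H)) \<and>
     (\<forall>v \<in> pverts (digraph_of G). nlabel H (\<gamma> v) = nlabel G v) \<and>
     (\<forall>u \<in> pverts (digraph_of G). \<forall>v \<in> pverts (digraph_of G).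
        (u, v) \<in> parcs (digraph_of G) \<longleftrightarrow> (\<gamma> u, \<gamma> v) \<in> parcs (digraph_of H))"

definition node_labeled_isomorphic ::
  "('a, 'l) node_labeled_digraph \<Rightarrow> ('b, 'l) node_labeled_digraph \<Rightarrow> bool" where
  "node_labeled_isomorphic G H \<longleftrightarrow> (\<exists>\<gamma>. is_node_labeled_iso G H \<gamma>)"

definition labeled_isomorphic ::
  "('a, 'l, 'm) labeled_digraph \<Rightarrow> ('b, 'l, 'm) labeled_digraph \<Rightarrow> bool" where
  "labeled_isomorphic G H \<longleftrightarrow>
     (\<exists>\<gamma>. is_node_labeled_iso G H \<gamma> \<and>
        (\<forall>(u, v) \<in> parcs (digraph_of G). elabel H (\<gamma> u, \<gamma> v) = elabel G (u, v)))"

datatype line_label = HT | TT | HH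

definition line_arcs :: "'a rel \<Rightarrow> ('a \<times> 'a) rel" where
  "line_arcs D = {(e, f). e \<in> D \<and> f \<in> D \<and> e \<noteq> f \<and>
     (snd e = fst f \<or> fst e = fst f \<or> snd e = snd f)}"

text \<open>
  The order of the tests is immaterial: without self-loops, exactly one of the three
  incidences holds on each arc of the line digraph (\<open>line_label_iff\<close> below). Off
  \<^const>\<open>line_arcs\<close> the value is irrelevant.
\<close>

definition line_label_of :: "('a \<times> 'a) \<times> ('a \<times> 'a) \<Rightarrow> line_label" where
  "line_label_of = (\<lambda>(e, f).
     if snd e = fst f then HT else if fst e = fst f then TT else HH)"

definition extended_line_digraph ::
  "('a, 'l) node_labeled_digraph \<Rightarrow> ('a \<times> 'a, 'l \<times> 'l, line_label) labeled_digraph" where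
  "extended_line_digraph G =
     \<lparr>digraph_of = \<lparr>pverts = parcs (digraph_of G), parcs = line_arcs (parcs (digraph_of G))\<rparr>,
      nlabel = (\<lambda>(u, v). (nlabel G u, nlabel G v)),
      elabel = line_label_of\<rparr>"

lemma line_label_iff:
  assumes "pair_loopfree_digraph (digraph_of G)"
    and "e \<in> parcs (digraph_of G)" "f \<in> parcs (digraph_of G)" "e \<noteq> f"
  defines "L \<equiv> extended_line_digraph G"
  shows "(e, f) \<in> parcs (digraph_of L) \<and> elabel L (e, f) = HT \<longleftrightarrow> snd e = fst f"
    and "(e, f) \<in> parcs (digraph_of L) \<and> elabel L (e, f) = TT \<longleftrightarrow> fst e = fst f"
    and "(e, f) \<in> parcs (digraph_of L) \<and> elabel L (e, f) = HH \<longleftrightarrow> snd e = snd f"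
proof -
  have "fst e \<noteq> snd e" "fst f \<noteq> snd f"
    using assms pair_loopfree_digraph.pair_no_loops by blast+
  then show
    "(e, f) \<in> parcs (digraph_of L) \<and> elabel L (e, f) = HT \<longleftrightarrow> snd e = fst f"
    "(e, f) \<in> parcs (digraph_of L) \<and> elabel L (e, f) = TT \<longleftrightarrow> fst e = fst f"
    "(e, f) \<in> parcs (digraph_of L) \<and> elabel L (e, f) = HH \<longleftrightarrow> snd e = snd f"
    using assms(2-4) unfolding L_def extended_line_digraph_def line_arcs_def line_label_of_def
    by (auto simp: prod_eq_iff)
qed

end

theory Submission
  imports Defs
begin

text \<open>
  The three arc labels record exactly which endpoints of two arcs coincide, so an isomorphism of
  extended line digraphs preserves all such coincidences. Sending an endpoint of an arc to the
  corresponding endpoint of its image is therefore well defined and injective, and it is defined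
  on every node: in a connected digraph with at least one arc, every node lies on an arc.
\<close>

lemma connected_node_on_arc:
  assumes "pair_digraph G" "Digraph_Component.connected G" "parcs G \<noteq> {}" "v \<in> pverts G"
  obtains e where "e \<in> parcs G" "v = fst e \<or> v = snd e"
proof -
  interpret pair_digraph G by fact
  obtain a b where ab: "(a, b) \<in> parcs G"
    using assms(3) by auto
  show thesis
  proof (cases "v = a")
    case True
    then show thesis
      using ab that by fastforce
  next
    case False
    have "v \<rightarrow>\<^sup>*\<^bsub>mk_symmetric G\<^esub> a"
      using assms(2,4) ab in_arcsD1[of a b]
      by (auto simp: Digraph_Component.connected_def strongly_connected_def)
    then have "(v, a) \<in> (parcs (mk_symmetric G))\<^sup>*"
      by (auto simp: reachable_def dest: rtrancl_on_rtranclI)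
    \<comment> \<open>Since \<open>v\<close> differs from \<open>a\<close>, the path is nonempty;
      its first step is an arc of the symmetric closure, so it or its reverse is an arc of
      \<open>G\<close> at \<open>v\<close>.\<close>
    with False obtain w where "(v, w) \<in> parcs (mk_symmetric G)"
      by (auto elim: converse_rtranclE)
    then show thesis
      using that by (fastforce simp: parcs_mk_symmetric)
  qed
qed

lemma extended_line_digraph_sel [simp]:
  "pverts (digraph_of (extended_line_digraph G)) = parcs (digraph_of G)"
  "parcs (digraph_of (extended_line_digraph G)) = line_arcs (parcs (digraph_of G))"
  "nlabel (extended_line_digraph G) e = (nlabel G (fst e), nlabel G (snd e))"
  "elabel (extended_line_digraph G) = line_label_of"
  by (simp_all add: extended_line_digraph_def case_prod_beta)

text \<open>A node isomorphism \<open>h\<close> acts on arcs componentwise. Being injective on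
  nodes, it preserves and reflects every coincidence of endpoints, and these coincidences alone
  determine the arcs and arc labels of the line digraph.\<close>

lemma extended_line_digraph_isomorphic:
  assumes "pair_digraph (digraph_of G)" "pair_digraph (digraph_of G')"
    and "node_labeled_isomorphic G G'"
  shows "labeled_isomorphic (extended_line_digraph G) (extended_line_digraph G')"
proof -
  let ?V = "pverts (digraph_of G)" and ?D = "parcs (digraph_of G)"
  let ?V' = "pverts (digraph_of G')" and ?D' = "parcs (digraph_of G')"
  interpret G: pair_digraph "digraph_of G" by fact
  interpret G': pair_digraph "digraph_of G'" by fact
  obtain h where bij: "bij_betw h ?V ?V'"
    and lab: "\<And>v. v \<in> ?V \<Longrightarrow> nlabel G' (h v) = nlabel G v"
    and arc: "\<And>u v. u \<in> ?V \<Longrightarrow> v \<in> ?V \<Longrightarrow> (u, v) \<in> ?D \<longleftrightarrow> (h u, h v) \<in> ?D'"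
    using assms(3) by (auto simp: node_labeled_isomorphic_def is_node_labeled_iso_def)
  have V: "fst e \<in> ?V" "snd e \<in> ?V" if "e \<in> ?D" for e
    using that by (auto intro: G.arc_fst_in_verts G.arc_snd_in_verts)
  have inj: "h u = h v \<longleftrightarrow> u = v" if "u \<in> ?V" "v \<in> ?V" for u v
    using bij that by (auto simp: bij_betw_def inj_on_def)
  let ?g = "map_prod h h"
  have D: "?g e \<in> ?D'" if "e \<in> ?D" for e
    using arc[of "fst e" "snd e"] V[OF that] that by (cases e) auto
  have injD: "?g e = ?g f \<longleftrightarrow> e = f" if "e \<in> ?D" "f \<in> ?D" for e f
    using V[OF that(1)] V[OF that(2)] by (cases e; cases f) (auto simp: inj)
  have bijD: "bij_betw ?g ?D ?D'"
  proof (rule bij_betw_imageI)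
    show "inj_on ?g ?D"
      using injD by (auto intro!: inj_onI)
    show "?g ` ?D = ?D'"
    proof (intro equalityI subsetI)
      fix e' assume e': "e' \<in> ?D'"
      obtain u' v' where uv': "e' = (u', v')" by (cases e')
      with e' have "u' \<in> ?V'" "v' \<in> ?V'"
        using G'.in_arcsD1 G'.in_arcsD2 by auto
      \<comment> \<open>Surjectivity on arcs needs \<open>arc\<close> in its reflecting direction:
        the preimages of the endpoints of \<open>e'\<close> are themselves joined by an arc.\<close>
      then obtain u v where "u \<in> ?V" "v \<in> ?V" "u' = h u" "v' = h v"
        using bij by (metis bij_betw_def imageE)
      then show "e' \<in> ?g ` ?D"
        using arc e' uv' by (auto intro!: image_eqI[of _ _ "(u, v)"])
    qed (use D in auto)
  qed
  have line: "(e, f) \<in> line_arcs ?D \<longleftrightarrow> (?g e, ?g f) \<in> line_arcs ?D'"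
    if "e \<in> ?D" "f \<in> ?D" for e f
    using that D V[OF that(1)] V[OF that(2)] by (simp add: line_arcs_def inj injD)
  have "line_label_of (?g e, ?g f) = line_label_of (e, f)" if "(e, f) \<in> line_arcs ?D" for e f
    using that V[of e] V[of f] by (auto simp: line_arcs_def line_label_of_def inj)
  then show ?thesis
    unfolding labeled_isomorphic_def is_node_labeled_iso_def
    using bijD line lab V by (intro exI[of _ ?g]) auto
qed

text \<open>The assumption of an arc on one side excludes two isolated nodes: their extended line
  digraphs are both empty, hence isomorphic, while the node labels may differ.\<close>

lemma isomorphic_if_extended_line_digraph_isomorphic:
  assumes "pair_digraph (digraph_of G)" "Digraph_Component.connected (digraph_of G)"
    and "pair_digraph (digraph_of G')" "Digraph_Component.connected (digraph_of G')"
    and "parcs (digraph_of G) \<noteq> {} \<or> parcs (digraph_of G') \<noteq> {}"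
    and "labeled_isomorphic (extended_line_digraph G) (extended_line_digraph G')"
  shows "node_labeled_isomorphic G G'"
proof -
  let ?V = "pverts (digraph_of G)" and ?D = "parcs (digraph_of G)"
  let ?V' = "pverts (digraph_of G')" and ?D' = "parcs (digraph_of G')"
  interpret G: pair_digraph "digraph_of G" by fact
  interpret G': pair_digraph "digraph_of G'" by fact
  obtain g where iso: "is_node_labeled_iso (extended_line_digraph G) (extended_line_digraph G') g"
    and "\<forall>(e, f)\<in>line_arcs ?D. line_label_of (g e, g f) = line_label_of (e, f)"
    using assms(6) unfolding labeled_isomorphic_def by auto
  then have eql: "line_label_of (g e, g f) = line_label_of (e, f)"
    if "(e, f) \<in> line_arcs ?D" for e f
    using that by fast
  have bij: "bij_betw g ?D ?D'"
    using iso by (simp add: is_node_labeled_iso_def)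
  have lab: "nlabel G' (fst (g e)) = nlabel G (fst e)" "nlabel G' (snd (g e)) = nlabel G (snd e)"
    if "e \<in> ?D" for e
    using iso that by (simp_all add: is_node_labeled_iso_def)
  have line: "(e, f) \<in> line_arcs ?D \<longleftrightarrow> (g e, g f) \<in> line_arcs ?D'"
    if "e \<in> ?D" "f \<in> ?D" for e f
    using iso that by (simp add: is_node_labeled_iso_def)
  have D: "g e \<in> ?D'" if "e \<in> ?D" for e
    using bij that by (auto simp: bij_betw_def)
  \<comment> \<open>For distinct arcs, \<open>line_label_iff\<close> turns each coincidence into an
    arc of the line digraph with a prescribed label, which \<open>g\<close> preserves and reflects.
    For \<open>e = f\<close> the head-tail coincidence fails on both sides, as there are no loops,
    and the other two hold trivially.\<close>
  have ends: "snd e = fst f \<longleftrightarrow> snd (g e) = fst (g f)"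
      "fst e = fst f \<longleftrightarrow> fst (g e) = fst (g f)"
      "snd e = snd f \<longleftrightarrow> snd (g e) = snd (g f)" if ef: "e \<in> ?D" "f \<in> ?D" for e f
  proof -
    have "(snd e = fst f \<longleftrightarrow> snd (g e) = fst (g f)) \<and>
      (fst e = fst f \<longleftrightarrow> fst (g e) = fst (g f)) \<and> (snd e = snd f \<longleftrightarrow> snd (g e) = snd (g f))"
    proof (cases "e = f")
      case True
      then show ?thesis
        using G.pair_no_loops[OF ef(1)] G'.pair_no_loops[OF D[OF ef(1)]] by auto
    next
      case False
      then have "g e \<noteq> g f"
        using bij ef by (auto simp: bij_betw_def inj_on_def)
      then show ?thesis
        using line_label_iff[OF G.pair_loopfree_digraph_axioms ef False]
          line_label_iff[OF G'.pair_loopfree_digraph_axioms D[OF ef(1)] D[OF ef(2)]]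
          line[OF ef] eql[of e f]
        unfolding extended_line_digraph_sel by metis
    qed
    then show "snd e = fst f \<longleftrightarrow> snd (g e) = fst (g f)"
      "fst e = fst f \<longleftrightarrow> fst (g e) = fst (g f)"
      "snd e = snd f \<longleftrightarrow> snd (g e) = snd (g f)" by auto
  qed
  have ne: "?D \<noteq> {}" "?D' \<noteq> {}"
    using assms(5) bij by (auto simp: bij_betw_def)
  \<comment> \<open>A node may lie on many arcs, so the induced node map starts as a relation, with
    one pair for each end of each arc. Well-definedness and injectivity are then the two directions
    of \<open>R_iff\<close>.\<close>
  define R where "R v v' \<longleftrightarrow>
    (\<exists>e\<in>?D. v = fst e \<and> v' = fst (g e) \<or> v = snd e \<and> v' = snd (g e))" for v v'
  have R_iff: "u = v \<longleftrightarrow> u' = v'" if "R u u'" "R v v'" for u v u' v'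
  proof -
    obtain e where e: "e \<in> ?D" "u = fst e \<and> u' = fst (g e) \<or> u = snd e \<and> u' = snd (g e)"
      using \<open>R u u'\<close> unfolding R_def by blast
    obtain f where f: "f \<in> ?D" "v = fst f \<and> v' = fst (g f) \<or> v = snd f \<and> v' = snd (g f)"
      using \<open>R v v'\<close> unfolding R_def by blast
    \<comment> \<open>The tail of \<open>e\<close> meeting the head of \<open>f\<close> is the
      head-tail case with the arcs swapped.\<close>
    have "fst e = snd f \<longleftrightarrow> fst (g e) = snd (g f)"
      using ends(1)[OF f(1) e(1)] by argo
    with e(2) f(2) show ?thesis
      by (elim disjE conjE) (simp_all only: ends[OF e(1) f(1)])
  qed
  have R_total: "\<exists>v'. R v v'" if v: "v \<in> ?V" for v
  proof -
    obtain e where "e \<in> ?D" "v = fst e \<or> v = snd e"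
      using connected_node_on_arc[OF assms(1,2) ne(1) v] .
    then show ?thesis
      unfolding R_def by blast
  qed
  have R_surj: "\<exists>v. R v v'" if v': "v' \<in> ?V'" for v'
  proof -
    obtain e' where e': "e' \<in> ?D'" "v' = fst e' \<or> v' = snd e'"
      using connected_node_on_arc[OF assms(3,4) ne(2) v'] .
    obtain e where "e \<in> ?D" "e' = g e"
      using e'(1) bij_betw_imp_surj_on[OF bij] by blast
    with e'(2) show ?thesis
      unfolding R_def by blast
  qed
  have R_verts: "v \<in> ?V" "v' \<in> ?V'" if "R v v'" for v v'
    using that D G.arc_fst_in_verts G.arc_snd_in_verts G'.arc_fst_in_verts G'.arc_snd_in_verts
    unfolding R_def by blast+
  have R_lab: "nlabel G' v' = nlabel G v" if "R v v'" for v v'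
    using that lab unfolding R_def by auto
  \<comment> \<open>The choice is harmless: by \<open>R_iff\<close> each node has only one partner
    under \<open>R\<close>.\<close>
  obtain h where h: "\<And>v. v \<in> ?V \<Longrightarrow> R v (h v)"
    using R_total by metis
  have "bij_betw h ?V ?V'"
  proof (rule bij_betw_imageI)
    show "inj_on h ?V"
      using R_iff[OF h h] by (intro inj_onI) simp
    show "h ` ?V = ?V'"
    proof (intro equalityI subsetI)
      fix v' assume "v' \<in> ?V'"
      then obtain v where "R v v'"
        using R_surj by blast
      then show "v' \<in> h ` ?V"
        using h[of v] R_iff[of v v' v "h v"] R_verts(1) by blast
    qed (use h R_verts(2) in blast)
  qed
  moreover have "(u, v) \<in> ?D \<longleftrightarrow> (h u, h v) \<in> ?D'" if uv: "u \<in> ?V" "v \<in> ?V" for u v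
  proof
    assume e: "(u, v) \<in> ?D"
    \<comment> \<open>The arc \<open>(u, v)\<close> itself witnesses both pairs, so uniqueness of
      partners gives \<open>g (u, v) = (h u, h v)\<close>.\<close>
    then have "R u (fst (g (u, v)))" "R v (snd (g (u, v)))"
      unfolding R_def by force+
    then have "h u = fst (g (u, v))" "h v = snd (g (u, v))"
      using R_iff[OF h[OF uv(1)]] R_iff[OF h[OF uv(2)]] by blast+
    then show "(h u, h v) \<in> ?D'"
      using D[OF e] by simp
  next
    assume "(h u, h v) \<in> ?D'"
    then obtain e where e: "e \<in> ?D" "g e = (h u, h v)"
      using bij by (metis bij_betw_def imageE)
    \<comment> \<open>Conversely, the \<open>g\<close>-preimage \<open>e\<close> has ends related to
      \<open>h u\<close> and \<open>h v\<close>; the injective direction of \<open>R_iff\<close>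
      forces these ends to be \<open>u\<close> and \<open>v\<close>.\<close>
    then have "R (fst e) (h u)" "R (snd e) (h v)"
      unfolding R_def by force+
    then have "fst e = u" "snd e = v"
      using R_iff[OF _ h[OF uv(1)]] R_iff[OF _ h[OF uv(2)]] by blast+
    then show "(u, v) \<in> ?D"
      using e by auto
  qed
  ultimately show ?thesis
    unfolding node_labeled_isomorphic_def is_node_labeled_iso_def
    using h R_lab by (intro exI[of _ h]) auto
qed

theorem theorem4p5:
  fixes G :: "('a, 'l) node_labeled_digraph"
    and G' :: "('b, 'l) node_labeled_digraph"
  assumes "pair_digraph (digraph_of G)" and "Digraph_Component.connected (digraph_of G)" and "oriented (digraph_of G)"
    and "pair_digraph (digraph_of G')" and "Digraph_Component.connected (digraph_of G')" and "oriented (digraph_of G')"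
    and not_both_edgeless: "parcs (digraph_of G) \<noteq> {} \<or> parcs (digraph_of G') \<noteq> {}"
  shows "labeled_isomorphic (extended_line_digraph G) (extended_line_digraph G')
    \<longleftrightarrow> node_labeled_isomorphic G G'"
  using isomorphic_if_extended_line_digraph_isomorphic[OF assms(1,2,4,5,7)]
    extended_line_digraph_isomorphic[OF assms(1,4)] by blast

end
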